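(* Let $A$ be an $n$-by-$n$ complex matrix such that $0\in\partial W(A)$. Then $d(A)\le\dim\bigvee\{x\in\mathbb{C}^n:\langle Ax,x\rangle=0\}$. Moreover, in this case, the equality $d(A)=\dim\bigvee\{x\in\mathbb{C}^n:\langle Ax,x\rangle=0\}$ holds if and only if $0$ is an extreme point of $W(A)$.
   Context: For an $n$-by-$n$ complex matrix $A$, the zero-dilation index $d(A)$ is the largest integer $k\ge 1$ such that there is an $n$-by-$k$ complex matrix $V$ with $V^*V=I_k$ and $V^*AV=0_k$, where $0_k$ is the $k$-by-$k$ zero matrix; if no such $k$ exists, $d(A)=0$. $W(A)=\{\langle Ax,x\rangle:x\in\mathbb{C}^n,\ \|x\|=1\}$ is the numerical range (a compact convex subset of $\mathbb{C}$) and $\partial W(A)$ is its boundary in $\mathbb{C}$. $\bigvee K$ denotes the linear span of $K\subseteq\mathbb{C}^n$. A point $\lambda$ is an extreme point of a convex set $\Delta$ if $\lambda\in\Delta$ and $\lambda$ cannot be written as $t\lambda_1+(1-t)\lambda_2$ with $0<t<1$ and $\lambda_1,\lambda_2\in\Delta$ both distinct from $\lambda$. *)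

theory Defs
  imports
    "HOL-Analysis.Analysis"
    "Jordan_Normal_Form.Schur_Decomposition"
    "Jordan_Normal_Form.DL_Rank"
begin

text \<open>Vectors and matrices carry their dimensions, so \<open>n\<close> is \<open>dim_row A\<close> below. The inner product
  \<open>x \<bullet>c y\<close> is the sum of \<open>x\<^sub>i\<close> times the conjugate of \<open>y\<^sub>i\<close>, hence linear in the first argument.\<close>

definition euclidean_norm :: "complex Matrix.vec \<Rightarrow> real" where
  "euclidean_norm x = sqrt (\<Sum>i<dim_vec x. (cmod (vec_index x i))\<^sup>2)"

definition numerical_range :: "complex mat \<Rightarrow> complex set" where
  "numerical_range A =
    {(A *\<^sub>v x) \<bullet>c x | x. x \<in> carrier_vec (dim_row A) \<and> euclidean_norm x = 1}"

definition has_zero_compression :: "complex mat \<Rightarrow> nat \<Rightarrow> bool" where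
  "has_zero_compression A k \<longleftrightarrow>
    (\<exists>V \<in> carrier_mat (dim_row A) k.
      mat_adjoint V * V = 1\<^sub>m k \<and> mat_adjoint V * A * V = 0\<^sub>m k k)"

text \<open>The first condition in \<open>has_zero_compression\<close> forces
  \<open>k \<le> dim_row A\<close>, so the \<open>GREATEST\<close> below is attained whenever some \<open>k \<ge> 1\<close> is admissible.\<close>

definition zero_dilation_index :: "complex mat \<Rightarrow> nat" where
  "zero_dilation_index A =
    (if \<exists>k\<ge>1. has_zero_compression A k
     then GREATEST k. k \<ge> 1 \<and> has_zero_compression A k
     else 0)"

definition isotropic_vectors :: "complex mat \<Rightarrow> complex Matrix.vec set" where
  "isotropic_vectors A = {x \<in> carrier_vec (dim_row A). (A *\<^sub>v x) \<bullet>c x = 0}"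

definition (in vec_space) dim_span :: "'a Matrix.vec set \<Rightarrow> nat" where
  "dim_span K = vectorspace.dim class_ring (span_vs K)"

end

theory Submission
  imports Defs "HOL-Library.Quadratic_Discriminant"
begin

text \<open>A zero compression of \<open>A\<close> is an orthonormal family on whose span the form \<open>\<langle>Ax, y\<rangle>\<close>
  vanishes, so that span consists of isotropic vectors; this bounds the index. By polarization,
  equality holds iff the isotropic vectors are closed under addition. Once \<open>0\<close> is in the numerical
  range (which is closed), this closure is equivalent to extremality of \<open>0\<close>, by computations in the
  span of two vectors, as in the proof of the Toeplitz-Hausdorff theorem.\<close>

section \<open>Spans and orthonormal families\<close>

lemma (in vec_space) submoduleI:
  assumes "P \<subseteq> carrier_vec n" "0\<^sub>v n \<in> P"
    and "\<And>x y. x \<in> P \<Longrightarrow> y \<in> P \<Longrightarrow> x + y \<in> P"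
    and "\<And>c x. x \<in> P \<Longrightarrow> c \<cdot>\<^sub>v x \<in> P"
  shows "submodule class_ring P V"
  using assms by unfold_locales (auto simp: class_ring_simps)

text \<open>Independent subsets of \<open>K\<close> have at most \<open>n\<close> elements, so a
  maximal one exists even for infinite \<open>K\<close>; by maximality every vector of
  \<open>K\<close> lies in its span.\<close>

lemma (in vec_space) obtain_basis_of_span:
  assumes K: "K \<subseteq> carrier_vec n"
  obtains B where "B \<subseteq> K" "finite B" "lin_indpt B" "span B = span K" "card B = dim_span K"
proof -
  let ?P = "\<lambda>B. B \<subseteq> K \<and> lin_indpt B"
  have "finite S \<and> card S \<le> n" if "?P S" for S
    using li_le_dim[OF fin_dim, of S] that K dim_is_n by auto
  moreover have "?P {}" by (auto simp: lin_dep_def)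
  ultimately obtain B where B: "finite B" "maximal B ?P"
    using maximal_exists[of ?P n "{}"] by blast
  then have BK: "B \<subseteq> K" and li: "lin_indpt B" by (auto simp: maximal_def)
  have Bc: "B \<subseteq> carrier_vec n" using BK K by blast
  have "v \<in> span B" if "v \<in> K" for v
  proof (rule ccontr)
    assume v: "v \<notin> span B"
    then have "v \<notin> B" using span_mem[of B v] Bc by auto
    then have "lin_indpt (B \<union> {v})"
      using lin_dep_iff_in_span[of B v] Bc li v that K by auto
    then have "B \<union> {v} = B" using B(2) BK that unfolding maximal_def by blast
    then show False using \<open>v \<notin> B\<close> by blast
  qed
  then have sp: "span B = span K"
    using span_is_monotone[OF BK] span_subsetI[OF Bc, of K] by blast
  have sub: "submodule class_ring (span B) V" using Bc by (intro span_is_submodule) auto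
  have in_span: "B \<subseteq> span B" using Bc in_own_span by auto
  have vs: "vectorspace class_ring (span_vs B)"
    using Bc span_is_subspace subspace_is_vs by simp
  \<comment> \<open>\<open>dim_span\<close> is computed inside the subspace
    \<open>span_vs B\<close>, so span and independence are transferred there from the ambient
    space.\<close>
  have "vectorspace.basis class_ring (span_vs B) B"
    unfolding vectorspace.basis_def[OF vs]
    using span_li_not_depend[OF in_span sub] li in_span by simp
  then have "card B = dim_span K"
    unfolding dim_span_def sp[symmetric] using vectorspace.dim_basis[OF vs B(1)] by simp
  with that BK B(1) li sp show thesis by blast
qed

text \<open>The bound limits the size of a zero compression; the equality case identifies the span
  of one of full size.\<close>

lemma (in vec_space)
  assumes K: "K \<subseteq> carrier_vec n" and S: "S \<subseteq> span K" "finite S" "lin_indpt S"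
  shows card_le_dim_span: "card S \<le> dim_span K"
    and span_eq_if_card_eq_dim_span: "card S = dim_span K \<Longrightarrow> span S = span K"
proof -
  obtain B where B: "B \<subseteq> K" "finite B" "span B = span K"
    using obtain_basis_of_span[OF K] by metis
  have sub: "submodule class_ring (span K) V" using K by (intro span_is_submodule) auto
  have vs: "vectorspace class_ring (span_vs K)"
    using K span_is_subspace subspace_is_vs by simp
  have fd: "vectorspace.fin_dim class_ring (span_vs K)"
    using fin_dim_span[of B] B K by auto
  have li: "\<not> module.lin_dep class_ring (span_vs K) S"
    using span_li_not_depend(2)[OF S(1) sub] S(3) by simp
  show "card S \<le> dim_span K"
    unfolding dim_span_def using vectorspace.li_le_dim(2)[OF vs fd _ li] S(1) by simp
  show "span S = span K" if "card S = dim_span K"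
  proof -
    have "vectorspace.basis class_ring (span_vs K) S"
      using vectorspace.dim_li_is_basis[OF vs fd S(2) _ li] S(1) that by (simp add: dim_span_def)
    then show ?thesis
      unfolding vectorspace.basis_def[OF vs] using span_li_not_depend(1)[OF S(1) sub] by simp
  qed
qed

text \<open>A list rather than a set, since it serves as the columns of the matrix in
  \<open>has_zero_compression\<close>. The condition on indices also excludes repetitions.\<close>

definition orthonormal_list :: "nat \<Rightarrow> complex Matrix.vec list \<Rightarrow> bool" where
  "orthonormal_list n vs \<longleftrightarrow> set vs \<subseteq> carrier_vec n \<and>
    (\<forall>i<length vs. \<forall>j<length vs. (vs ! i) \<bullet>c (vs ! j) = (if i = j then 1 else 0))"

lemma orthonormal_list_distinct:
  assumes "orthonormal_list n vs"
  shows "distinct vs"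
  unfolding distinct_conv_nth
  using assms unfolding orthonormal_list_def by (metis zero_neq_one)

text \<open>Pairing a vanishing combination with a member \<open>v\<close> of the list isolates the
  coefficient of \<open>v\<close>.\<close>

lemma orthonormal_list_lin_indpt:
  assumes "orthonormal_list n vs"
  shows "\<not> module.lin_dep class_ring (module_vec TYPE(complex) n) (set vs)"
proof -
  interpret vec_space "TYPE(complex)" n .
  have c: "set vs \<subseteq> carrier_vec n" using assms by (simp add: orthonormal_list_def)
  show ?thesis
  proof (rule finite_lin_indpt2)
    fix a assume a: "lincomb a (set vs) = 0\<^sub>v n"
    show "\<forall>v\<in>set vs. a v = 0"
    proof
      fix v assume v: "v \<in> set vs"
      have orth: "w \<bullet>c v = (if w = v then 1 else 0)" if "w \<in> set vs" for w
        using that v assms unfolding orthonormal_list_def in_set_conv_nth by (metis zero_neq_one)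
      have vc: "conjugate v \<in> carrier_vec n" using v c by auto
      have "0 = scalar_prod (lincomb a (set vs)) (conjugate v)" using a vc by simp
      also have "\<dots> = (\<Sum>w\<in>set vs. scalar_prod (a w \<cdot>\<^sub>v w) (conjugate v))"
        unfolding lincomb_def using c vc by (subst finsum_scalar_prod_sum) auto
      also have "\<dots> = (\<Sum>w\<in>set vs. if w = v then a w else 0)"
      proof (rule sum.cong)
        fix w assume w: "w \<in> set vs"
        then have "scalar_prod (a w \<cdot>\<^sub>v w) (conjugate v) = a w * (w \<bullet>c v)"
          using c vc by (intro smult_scalar_prod_distrib) auto
        then show "scalar_prod (a w \<cdot>\<^sub>v w) (conjugate v) = (if w = v then a w else 0)"
          using orth[OF w] by auto
      qed simp
      also have "\<dots> = a v" using v by simp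
      finally show "a v = 0" by simp
    qed
  qed (use c in auto)
qed

lemma euclidean_norm_sq:
  "complex_of_real ((euclidean_norm x)\<^sup>2) = x \<bullet>c x"
proof -
  have "(euclidean_norm x)\<^sup>2 = (\<Sum>i<dim_vec x. (cmod (vec_index x i))\<^sup>2)"
    unfolding euclidean_norm_def by (rule real_sqrt_pow2) (simp add: sum_nonneg)
  then show ?thesis
    by (simp add: scalar_prod_def lessThan_atLeast0 complex_norm_square del: of_real_power)
qed

lemma euclidean_norm_pos:
  assumes "x \<in> carrier_vec n" "x \<noteq> 0\<^sub>v n"
  shows "euclidean_norm x > 0"
proof -
  have "euclidean_norm x \<noteq> 0"
    using assms euclidean_norm_sq[of x] conjugate_square_eq_0_vec[of x n] by auto
  then show ?thesis by (simp add: euclidean_norm_def sum_nonneg order_less_le)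
qed

text \<open>Gram-Schmidt on a basis of the span chosen from \<open>K\<close>, followed by
  normalisation.\<close>

lemma obtain_orthonormal_list:
  assumes K: "K \<subseteq> carrier_vec n"
  obtains vs where "orthonormal_list n vs" "length vs = vec_space.dim_span n K"
    "set vs \<subseteq> module.span class_ring (module_vec TYPE(complex) n) K"
proof -
  interpret cof_vec_space n "TYPE(complex)" .
  obtain B where B: "B \<subseteq> K" "finite B" "lin_indpt B" "span B = span K" "card B = dim_span K"
    using obtain_basis_of_span[OF K] by metis
  obtain ws where ws: "set ws = B" "distinct ws"
    using finite_distinct_list[OF B(2)] by blast
  define us where "us = gram_schmidt n ws"
  note gs = gram_schmidt_result[of ws us]
  have wsc: "set ws \<subseteq> carrier_vec n" using ws B K by auto
  have us: "span (set us) = span K" "corthogonal us" "set us \<subseteq> carrier_vec n"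
    "length us = dim_span K"
    using gs[OF wsc ws(2) _ us_def] B ws distinct_card[OF ws(2)] by auto
  \<comment> \<open>\<open>corthogonal\<close> gives nonzero, pairwise orthogonal vectors, but not
    unit ones; \<open>N\<close> supplies the scaling factors.\<close>
  define N :: "complex Matrix.vec \<Rightarrow> complex" where "N u = complex_of_real (1 / euclidean_norm u)" for u
  define vs where "vs = map (\<lambda>u. N u \<cdot>\<^sub>v u) us"
  have ip: "(vs ! i) \<bullet>c (vs ! j) = (if i = j then 1 else 0)"
    if ij: "i < length us" "j < length us" for i j
  proof -
    have ui: "us ! i \<in> carrier_vec n" and uj: "us ! j \<in> carrier_vec n" using us(3) ij by auto
    have "(vs ! i) \<bullet>c (vs ! j) = N (us ! i) * cnj (N (us ! j)) * ((us ! i) \<bullet>c (us ! j))"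
      using ij ui uj by (simp add: vs_def conjugate_smult_vec)
    moreover have "N (us ! i) * cnj (N (us ! i)) * ((us ! i) \<bullet>c (us ! i)) = 1"
    proof -
      have "us ! i \<bullet>c us ! i \<noteq> 0" using corthogonalD[OF us(2) ij(1) ij(1)] by simp
      then have "euclidean_norm (us ! i) \<noteq> 0" using euclidean_norm_sq[of "us ! i"] by auto
      then show ?thesis
        unfolding euclidean_norm_sq[symmetric] N_def by (simp add: power2_eq_square)
    qed
    ultimately show ?thesis using corthogonalD[OF us(2) ij] by auto
  qed
  have vsc: "set vs \<subseteq> span K"
  proof -
    have "u \<in> span K" if "u \<in> set us" for u
      using span_mem[of "set us" u] us that by auto
    then have "N u \<cdot>\<^sub>v u \<in> span K" if "u \<in> set us" for u
      using that by (intro smult_in_span[OF K])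
    then show ?thesis unfolding vs_def set_map by (intro image_subsetI)
  qed
  moreover have "orthonormal_list n vs"
    unfolding orthonormal_list_def using ip us(3) by (auto simp: vs_def)
  ultimately show thesis using that us(4) by (auto simp: vs_def)
qed

section \<open>The sesquilinear form of a matrix\<close>

abbreviation sesq :: "complex mat \<Rightarrow> complex Matrix.vec \<Rightarrow> complex Matrix.vec \<Rightarrow> complex" where
  "sesq A x y \<equiv> (A *\<^sub>v x) \<bullet>c y"

context
  fixes A :: "complex mat" and n :: nat
  assumes A: "A \<in> carrier_mat n n"
begin

lemma sesq_add_left:
  assumes "x \<in> carrier_vec n" "y \<in> carrier_vec n" "z \<in> carrier_vec n"
  shows "sesq A (x + y) z = sesq A x z + sesq A y z"
  using A assms by (simp add: mult_add_distrib_mat_vec[of _ n n] add_scalar_prod_distrib[of _ n])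

lemma sesq_add_right:
  assumes "x \<in> carrier_vec n" "y \<in> carrier_vec n" "z \<in> carrier_vec n"
  shows "sesq A z (x + y) = sesq A z x + sesq A z y"
  using A assms by (simp add: conjugate_add_vec[of _ n] scalar_prod_add_distrib[of _ n])

lemma sesq_smult_left:
  assumes "x \<in> carrier_vec n" "y \<in> carrier_vec n"
  shows "sesq A (c \<cdot>\<^sub>v x) y = c * sesq A x y"
  using A assms by (simp add: mult_mat_vec[of _ n n])

lemma sesq_smult_right:
  assumes "x \<in> carrier_vec n" "y \<in> carrier_vec n"
  shows "sesq A x (c \<cdot>\<^sub>v y) = cnj c * sesq A x y"
  using A assms by (simp add: conjugate_smult_vec)

lemma sesq_zero_left:
  assumes "x \<in> carrier_vec n"
  shows "sesq A (0\<^sub>v n) x = 0"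
proof -
  have "0\<^sub>v n = 0 \<cdot>\<^sub>v x" using assms by (intro eq_vecI) auto
  then show ?thesis using sesq_smult_left[of x x 0] assms by simp
qed

lemmas sesq_simps = sesq_add_left sesq_add_right sesq_smult_left sesq_smult_right sesq_zero_left

lemma mem_isotropic_vectors:
  "x \<in> isotropic_vectors A \<longleftrightarrow> x \<in> carrier_vec n \<and> sesq A x x = 0"
  using A by (simp add: isotropic_vectors_def)

lemma isotropic_vectors_carrier: "isotropic_vectors A \<subseteq> carrier_vec n"
  by (auto simp: mem_isotropic_vectors)

lemma isotropic_vectors_smult:
  "x \<in> isotropic_vectors A \<Longrightarrow> c \<cdot>\<^sub>v x \<in> isotropic_vectors A"
  by (auto simp: mem_isotropic_vectors sesq_simps)

lemma zero_isotropic: "0\<^sub>v n \<in> isotropic_vectors A"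
  using A by (simp add: mem_isotropic_vectors)

text \<open>One argument at a time: the vectors on which the form vanishes against a fixed vector,
  on either side, form a subspace.\<close>

lemma sesq_zero_on_span:
  assumes "W \<subseteq> carrier_vec n" "\<And>x y. x \<in> W \<Longrightarrow> y \<in> W \<Longrightarrow> sesq A x y = 0"
    and "x \<in> module.span class_ring (module_vec TYPE(complex) n) W"
    and "y \<in> module.span class_ring (module_vec TYPE(complex) n) W"
  shows "sesq A x y = 0"
proof -
  interpret vec_space "TYPE(complex)" n .
  have left: "sesq A x y = 0" if "x \<in> span W" "y \<in> W" for x y
  proof -
    have "submodule class_ring {x \<in> carrier_vec n. sesq A x y = 0} V"
      using A subsetD[OF assms(1) that(2)] by (intro submoduleI) (auto simp: sesq_simps)
    from span_is_subset[OF _ this, of W] show ?thesis using assms that by auto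
  qed
  have "x \<in> carrier_vec n" using assms(1,3) span_is_subset2[of W] by auto
  then have "submodule class_ring {y \<in> carrier_vec n. sesq A x y = 0} V"
    using A by (intro submoduleI) (auto simp: sesq_simps)
  from span_is_subset[OF _ this, of W] show ?thesis using assms left[OF assms(3)] by auto
qed

text \<open>Isotropy of \<open>x + y\<close> makes the sum of the two cross terms vanish, and
  isotropy of \<open>x + \<i> \<cdot>\<^sub>v y\<close> their difference.\<close>

lemma sesq_zero_if_isotropic_add:
  assumes add: "\<And>x y. x \<in> isotropic_vectors A \<Longrightarrow> y \<in> isotropic_vectors A \<Longrightarrow> x + y \<in> isotropic_vectors A"
    and x: "x \<in> isotropic_vectors A" and y: "y \<in> isotropic_vectors A"
  shows "sesq A x y = 0"
proof -
  have "sesq A (x + y) (x + y) = 0" "sesq A (x + \<i> \<cdot>\<^sub>v y) (x + \<i> \<cdot>\<^sub>v y) = 0"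
    using add[OF x y] add[OF x isotropic_vectors_smult[OF y, of \<i>]]
    by (auto simp: mem_isotropic_vectors)
  then have "sesq A x y + sesq A y x = 0" "\<i> * (sesq A y x - sesq A x y) = 0"
    using x y by (auto simp: mem_isotropic_vectors sesq_simps algebra_simps)
  then show ?thesis by simp
qed

text \<open>Isotropic vectors always contain zero and are closed under scalars; addition is the one
  subspace axiom that has to be assumed.\<close>

lemma span_isotropic_vectors:
  assumes "\<And>x y. x \<in> isotropic_vectors A \<Longrightarrow> y \<in> isotropic_vectors A \<Longrightarrow> x + y \<in> isotropic_vectors A"
  shows "module.span class_ring (module_vec TYPE(complex) n) (isotropic_vectors A) = isotropic_vectors A"
proof -
  interpret vec_space "TYPE(complex)" n .
  have "submodule class_ring (isotropic_vectors A) V"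
    using assms isotropic_vectors_carrier isotropic_vectors_smult zero_isotropic
    by (intro submoduleI) auto
  then have "span (isotropic_vectors A) \<subseteq> isotropic_vectors A"
    by (intro span_is_subset) auto
  moreover have "isotropic_vectors A \<subseteq> span (isotropic_vectors A)"
    using isotropic_vectors_carrier by (intro in_own_span) auto
  ultimately show ?thesis by blast
qed

section \<open>Zero compressions\<close>

text \<open>The entries of both matrix products are inner products of columns, so the admissible
  \<open>V\<close> are exactly the matrices with such a list as columns.\<close>

lemma has_zero_compression_iff:
  "has_zero_compression A k \<longleftrightarrow>
    (\<exists>vs. orthonormal_list n vs \<and> length vs = k \<and> (\<forall>x\<in>set vs. \<forall>y\<in>set vs. sesq A x y = 0))"
proof -
  \<comment> \<open>The adjoint conjugates the left factor while \<open>\<bullet>c\<close>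
    conjugates its second argument, hence the swapped order.\<close>
  have idx: "(mat_adjoint V * B) $$ (i, j) = col B j \<bullet>c col V i"
    if "V \<in> carrier_mat n k" "B \<in> carrier_mat n k" "i < k" "j < k" for V B and i j :: nat
  proof -
    have "(mat_adjoint V * B) $$ (i, j) = scalar_prod (conjugate (col V i)) (col B j)"
      using that by (simp add: mat_adjoint_def)
    also have "\<dots> = col B j \<bullet>c col V i"
      using that by (intro conjugate_vec_sprod_comm[symmetric, of _ n]) auto
    finally show ?thesis .
  qed
  have carr: "mat_adjoint V * B \<in> carrier_mat k k"
    if "V \<in> carrier_mat n k" "B \<in> carrier_mat n k" for V B :: "complex mat"
    using that by (auto simp: mat_adjoint_def)
  have assoc: "mat_adjoint V * A * V = mat_adjoint V * (A * V)"
    if "V \<in> carrier_mat n k" for V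
    using that A by (intro assoc_mult_mat[of _ k n _ n _ k]) (auto simp: mat_adjoint_def)
  have V: "mat_adjoint V * V = 1\<^sub>m k \<and> mat_adjoint V * A * V = 0\<^sub>m k k \<longleftrightarrow>
      orthonormal_list n (cols V) \<and> (\<forall>x\<in>set (cols V). \<forall>y\<in>set (cols V). sesq A x y = 0)"
    if V: "V \<in> carrier_mat n k" for V
  proof -
    have AV: "A * V \<in> carrier_mat n k" using A V by simp
    have "mat_adjoint V * V = 1\<^sub>m k \<longleftrightarrow>
        (\<forall>i<k. \<forall>j<k. col V j \<bullet>c col V i = (if i = j then 1 else 0))"
      using carr[OF V V] by (auto simp: mat_eq_iff idx[OF V V])
    moreover have "mat_adjoint V * A * V = 0\<^sub>m k k \<longleftrightarrow>
        (\<forall>i<k. \<forall>j<k. sesq A (col V j) (col V i) = 0)"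
    proof -
      have "(mat_adjoint V * (A * V)) $$ (i, j) = sesq A (col V j) (col V i)" if "i < k" "j < k" for i j
        unfolding idx[OF V AV that] using col_mult2[OF A V that(2)] by simp
      then show ?thesis
        unfolding assoc[OF V] using V A by (auto simp: mat_eq_iff mat_adjoint_def)
    qed
    moreover have "set (cols V) = col V ` {..<k}" using V by (auto simp: cols_def)
    ultimately show ?thesis using V cols_dim[of V] by (auto simp: orthonormal_list_def)
  qed
  show ?thesis
  proof
    assume "has_zero_compression A k"
    then obtain V where "V \<in> carrier_mat n k" "mat_adjoint V * V = 1\<^sub>m k" "mat_adjoint V * A * V = 0\<^sub>m k k"
      using A unfolding has_zero_compression_def by auto
    then show "\<exists>vs. orthonormal_list n vs \<and> length vs = k \<and> (\<forall>x\<in>set vs. \<forall>y\<in>set vs. sesq A x y = 0)"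
      using V[of V] by (intro exI[of _ "cols V"]) auto
  next
    assume "\<exists>vs. orthonormal_list n vs \<and> length vs = k \<and> (\<forall>x\<in>set vs. \<forall>y\<in>set vs. sesq A x y = 0)"
    then obtain vs where vs: "orthonormal_list n vs" "length vs = k"
      "\<forall>x\<in>set vs. \<forall>y\<in>set vs. sesq A x y = 0" by blast
    then have "cols (mat_of_cols n vs) = vs" by (intro cols_mat_of_cols) (auto simp: orthonormal_list_def)
    moreover have "mat_of_cols n vs \<in> carrier_mat n k" using vs(2) by auto
    ultimately show "has_zero_compression A k"
      unfolding has_zero_compression_def using V[of "mat_of_cols n vs"] vs A by auto
  qed
qed

text \<open>Taking \<open>y = x\<close> shows that every member of the list is isotropic, so the
  list is an independent family inside the span of the isotropic vectors.\<close>

lemma zero_compression_le_dim_span: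
  assumes "orthonormal_list n vs" "\<forall>x\<in>set vs. \<forall>y\<in>set vs. sesq A x y = 0"
  shows "length vs \<le> vec_space.dim_span n (isotropic_vectors A)"
    and "length vs = vec_space.dim_span n (isotropic_vectors A) \<Longrightarrow>
      module.span class_ring (module_vec TYPE(complex) n) (set vs) =
      module.span class_ring (module_vec TYPE(complex) n) (isotropic_vectors A)"
proof -
  interpret vec_space "TYPE(complex)" n .
  have "set vs \<subseteq> isotropic_vectors A"
    using assms by (auto simp: orthonormal_list_def mem_isotropic_vectors)
  then have "set vs \<subseteq> span (isotropic_vectors A)"
    using in_own_span[of "isotropic_vectors A"] isotropic_vectors_carrier by auto
  note * = isotropic_vectors_carrier this finite_set orthonormal_list_lin_indpt[OF assms(1)]
  have "card (set vs) = length vs"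
    using orthonormal_list_distinct[OF assms(1)] by (rule distinct_card)
  then show "length vs \<le> dim_span (isotropic_vectors A)"
    and "length vs = dim_span (isotropic_vectors A) \<Longrightarrow> span (set vs) = span (isotropic_vectors A)"
    using card_le_dim_span[OF *] span_eq_if_card_eq_dim_span[OF *] by auto
qed

lemma has_zero_compression_le_dim_span:
  "has_zero_compression A k \<Longrightarrow> k \<le> vec_space.dim_span n (isotropic_vectors A)"
  unfolding has_zero_compression_iff using zero_compression_le_dim_span(1) by auto

text \<open>The dimension of the isotropic span bounds all admissible sizes, so the
  \<open>GREATEST\<close> is attained.\<close>

lemma has_zero_compression_zero_dilation_index: "has_zero_compression A (zero_dilation_index A)"
proof (cases "\<exists>k\<ge>1. has_zero_compression A k")
  case True
  then obtain k where "1 \<le> k \<and> has_zero_compression A k" by blast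
  from GreatestI_nat[where P = "\<lambda>k. 1 \<le> k \<and> has_zero_compression A k", OF this,
      of "vec_space.dim_span n (isotropic_vectors A)"]
  show ?thesis using True has_zero_compression_le_dim_span by (auto simp: zero_dilation_index_def)
next
  case False
  \<comment> \<open>The empty list is a compression of size 0, which matches the default value of
    the index.\<close>
  have "has_zero_compression A 0"
    unfolding has_zero_compression_iff by (auto simp: orthonormal_list_def)
  then show ?thesis using False by (simp only: zero_dilation_index_def if_False)
qed

lemma has_zero_compression_le_index:
  assumes "has_zero_compression A k"
  shows "k \<le> zero_dilation_index A"
proof (cases "1 \<le> k")
  case True
  with assms have *: "1 \<le> k \<and> has_zero_compression A k" by blast
  from Greatest_le_nat[where P = "\<lambda>k. 1 \<le> k \<and> has_zero_compression A k", OF this,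
      of "vec_space.dim_span n (isotropic_vectors A)"]
  show ?thesis using * has_zero_compression_le_dim_span by (auto simp: zero_dilation_index_def)
qed simp

lemma zero_dilation_index_eq_iff_isotropic_add:
  "zero_dilation_index A = vec_space.dim_span n (isotropic_vectors A) \<longleftrightarrow>
    (\<forall>x\<in>isotropic_vectors A. \<forall>y\<in>isotropic_vectors A. x + y \<in> isotropic_vectors A)"
proof -
  interpret vec_space "TYPE(complex)" n .
  let ?K = "isotropic_vectors A"
  note Kc = isotropic_vectors_carrier
  show ?thesis
  proof
    assume eq: "zero_dilation_index A = dim_span ?K"
    from has_zero_compression_zero_dilation_index obtain vs
      where vs: "orthonormal_list n vs" "length vs = dim_span ?K"
        "\<forall>x\<in>set vs. \<forall>y\<in>set vs. sesq A x y = 0"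
      unfolding eq has_zero_compression_iff by blast
    \<comment> \<open>A compression of full size spans all isotropic vectors, so the form vanishes
      on every pair of them and the cross terms of \<open>x + y\<close> drop out.\<close>
    have sp: "span (set vs) = span ?K" by (rule zero_compression_le_dim_span(2)[OF vs(1,3,2)])
    have "?K \<subseteq> span (set vs)" unfolding sp using Kc in_own_span by auto
    moreover have "set vs \<subseteq> carrier_vec n" using vs(1) by (simp add: orthonormal_list_def)
    ultimately have zero: "sesq A x y = 0" if "x \<in> ?K" "y \<in> ?K" for x y
      using sesq_zero_on_span[of "set vs" x y] vs(3) that by auto
    show "\<forall>x\<in>?K. \<forall>y\<in>?K. x + y \<in> ?K"
    proof (intro ballI)
      fix x y assume xy: "x \<in> ?K" "y \<in> ?K"
      then have "x \<in> carrier_vec n" "y \<in> carrier_vec n" using Kc by auto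
      with zero[OF xy] zero[OF xy(2,1)] xy show "x + y \<in> ?K"
        by (simp add: mem_isotropic_vectors sesq_simps)
    qed
  next
    assume add: "\<forall>x\<in>?K. \<forall>y\<in>?K. x + y \<in> ?K"
    obtain vs where vs: "orthonormal_list n vs" "length vs = dim_span ?K" "set vs \<subseteq> span ?K"
      using obtain_orthonormal_list[OF Kc] by blast
    \<comment> \<open>The isotropic vectors are now a subspace, so an orthonormal basis of their
      span is itself isotropic; polarization then makes it a zero compression.\<close>
    have "set vs \<subseteq> ?K" using vs(3) span_isotropic_vectors add by auto
    then have "has_zero_compression A (dim_span ?K)"
      unfolding has_zero_compression_iff
      using vs sesq_zero_if_isotropic_add add by (intro exI[of _ vs]) blast
    from has_zero_compression_le_index[OF this]
    show "zero_dilation_index A = dim_span ?K"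
      using has_zero_compression_le_dim_span[OF has_zero_compression_zero_dilation_index] by simp
  qed
qed

section \<open>The numerical range\<close>

text \<open>Scaling \<open>x\<close> by a scalar multiplies the form by the squared modulus, so the
  quotient is the value at the unit vector along \<open>x\<close>.\<close>

lemma normalized_mem_numerical_range:
  assumes x: "x \<in> carrier_vec n" "x \<noteq> 0\<^sub>v n"
  shows "sesq A x x / complex_of_real ((euclidean_norm x)\<^sup>2) \<in> numerical_range A"
proof -
  let ?r = "euclidean_norm x"
  let ?y = "complex_of_real (1 / ?r) \<cdot>\<^sub>v x"
  have r: "?r > 0" using euclidean_norm_pos[OF x] .
  have "euclidean_norm ?y = \<bar>1 / ?r\<bar> * ?r"
    by (simp add: euclidean_norm_def norm_mult norm_divide power_mult_distrib power_divide
        sum_divide_distrib[symmetric] real_sqrt_divide sum_nonneg)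
  then have "euclidean_norm ?y = 1" using r by simp
  moreover have "sesq A ?y ?y = sesq A x x / complex_of_real (?r\<^sup>2)"
    using x by (simp add: sesq_simps power2_eq_square)
  ultimately show ?thesis
    unfolding numerical_range_def using x A by (auto intro!: exI[of _ ?y])
qed

text \<open>The parallelogram law makes the form take opposite values at \<open>x + y\<close> and \<open>x - y\<close>, so that
  \<open>0\<close> lies between two normalised values.\<close>

lemma isotropic_add_if_extreme:
  assumes ext: "0 extreme_point_of numerical_range A"
    and x: "x \<in> isotropic_vectors A" and y: "y \<in> isotropic_vectors A"
  shows "x + y \<in> isotropic_vectors A"
proof -
  have xc: "x \<in> carrier_vec n" and yc: "y \<in> carrier_vec n"
    using x y by (auto simp: mem_isotropic_vectors)
  define m where "m = x + (-1) \<cdot>\<^sub>v y"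
  define p where "p = x + y"
  have mc: "m \<in> carrier_vec n" and pc: "p \<in> carrier_vec n" using xc yc by (auto simp: m_def p_def)
  have opp: "sesq A m m = - sesq A p p"
    using x y by (simp add: m_def p_def mem_isotropic_vectors sesq_simps)
  have "sesq A p p = 0"
  proof (rule ccontr)
    assume z: "sesq A p p \<noteq> 0"
    have p0: "p \<noteq> 0\<^sub>v n" using z A by auto
    have m0: "m \<noteq> 0\<^sub>v n" using z opp A by auto
    define P where "P = (euclidean_norm p)\<^sup>2"
    define M where "M = (euclidean_norm m)\<^sup>2"
    have pos: "P > 0" "M > 0"
      using euclidean_norm_pos[OF pc p0] euclidean_norm_pos[OF mc m0] by (auto simp: P_def M_def)
    let ?a = "sesq A p p / of_real P" and ?b = "sesq A m m / of_real M"
    have "?a \<in> numerical_range A" "?b \<in> numerical_range A"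
      unfolding P_def M_def
      using normalized_mem_numerical_range[OF pc p0] normalized_mem_numerical_range[OF mc m0] by auto
    moreover have "0 \<in> open_segment ?a ?b"
    proof -
      have "complex_of_real P + of_real M \<noteq> 0" using pos by (simp flip: of_real_add)
      \<comment> \<open>An open segment needs distinct endpoints; this identity shows that
        \<open>?a = ?b\<close> would force the form to vanish at \<open>p\<close>.\<close>
      moreover have "(of_real P + of_real M) * sesq A p p = of_real P * of_real M * (?a - ?b)"
        unfolding opp using pos by (simp add: field_simps)
      ultimately have "?a \<noteq> ?b" using z by auto
      \<comment> \<open>Weights proportional to \<open>P\<close> and \<open>M\<close> cancel the
        denominators of \<open>?a\<close> and \<open>?b\<close>, leaving the sum of two opposite
        values.\<close>
      moreover have "0 = (1 - M / (P + M)) *\<^sub>R ?a + (M / (P + M)) *\<^sub>R ?b"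
      proof -
        have "1 - M / (P + M) = P / (P + M)" using pos by (simp add: field_simps)
        then show ?thesis
          unfolding opp scaleR_conv_of_real using pos by simp
      qed
      ultimately show ?thesis
        unfolding in_segment using pos by (intro conjI exI[of _ "M / (P + M)"]) auto
    qed
    ultimately show False using ext by (auto simp: extreme_point_of_def)
  qed
  then show ?thesis using pc by (simp add: mem_isotropic_vectors p_def)
qed

text \<open>The phase \<open>w\<close> rotates the cross terms of the form along \<open>u + s w v\<close> onto the line through
  its values at \<open>u\<close> and \<open>v\<close>; what is left is a real quadratic in \<open>s\<close> with two distinct roots.\<close>

lemma extreme_if_isotropic_add:
  assumes zero: "0 \<in> numerical_range A"
    and add: "\<And>x y. x \<in> isotropic_vectors A \<Longrightarrow> y \<in> isotropic_vectors A \<Longrightarrow> x + y \<in> isotropic_vectors A"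
  shows "0 extreme_point_of numerical_range A"
  unfolding extreme_point_of_def
proof (intro conjI zero ballI notI)
  fix a b assume a: "a \<in> numerical_range A" and b: "b \<in> numerical_range A"
    and seg: "0 \<in> open_segment a b"
  obtain u where u: "u \<in> carrier_vec n" "a = sesq A u u" using a A by (auto simp: numerical_range_def)
  obtain v where v: "v \<in> carrier_vec n" "b = sesq A v v" using b A by (auto simp: numerical_range_def)
  from seg obtain t where t: "a \<noteq> b" "0 < t" "t < 1" "0 = (1 - t) *\<^sub>R a + t *\<^sub>R b"
    by (auto simp: in_segment)
  have b0: "b \<noteq> 0" using t by auto
  \<comment> \<open>The points \<open>a\<close> and \<open>b\<close> lie on opposite rays from the
    origin, and \<open>r\<close> is the ratio of their moduli. Dividing by \<open>b\<close> below
    turns the values at \<open>u\<close> and \<open>v\<close> into the reals \<open>- r\<close> and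
    \<open>1\<close>.\<close>
  define r where "r = t / (1 - t)"
  have r: "r > 0" using t by (simp add: r_def)
  have ab: "a = - of_real r * b"
  proof -
    have "of_real (1 - t) * a = - of_real t * b"
      using t(4) by (simp add: scaleR_conv_of_real eq_neg_iff_add_eq_0)
    moreover have "complex_of_real (1 - t) \<noteq> 0" using t by simp
    ultimately show ?thesis unfolding r_def of_real_divide by (simp add: field_simps)
  qed
  define p where "p = sesq A u v / b"
  define q where "q = sesq A v u / b"
  \<comment> \<open>This choice makes \<open>w * (q - cnj p)\<close> a squared modulus, hence real.
    If the factor is already zero, any nonzero \<open>w\<close> works. No unit modulus is imposed;
    \<open>c\<close> records the squared modulus of \<open>w\<close>.\<close>
  define w where "w = (if q = cnj p then 1 else cnj (q - cnj p))"
  have w0: "w \<noteq> 0" by (auto simp: w_def)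
  have "Im (cnj w * p + w * q) = Im (w * (q - cnj p))" by (simp add: algebra_simps)
  also have "\<dots> = 0" by (simp add: w_def algebra_simps)
  finally obtain m :: real where m: "cnj w * p + w * q = of_real m"
    by (metis complex_is_Real_iff Reals_cases)
  define c where "c = (cmod w)\<^sup>2"
  have c: "c > 0" "w * cnj w = of_real c" using w0 by (auto simp: c_def complex_norm_square simp del: of_real_power)
  \<comment> \<open>The discriminant is \<open>m\<^sup>2 + 4 * c * r\<close>, positive because
    \<open>c\<close> and \<open>r\<close> are.\<close>
  have "discrim c m (- r) > 0"
    using c r by (simp add: discrim_def add_nonneg_pos)
  then obtain s1 s2 where s: "s1 \<noteq> s2" "c * s1\<^sup>2 + m * s1 + - r = 0" "c * s2\<^sup>2 + m * s2 + - r = 0"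
    using discriminant_pos_ex[of c m "- r"] c by auto
  have mem: "u + (of_real s * w) \<cdot>\<^sub>v v \<in> isotropic_vectors A" (is "?x \<in> _")
    if "c * s\<^sup>2 + m * s + - r = 0" for s
  proof -
    have uv: "sesq A u v = p * b" "sesq A v u = q * b" using b0 by (auto simp: p_def q_def)
    have "sesq A ?x ?x = a + of_real s * (cnj w * p + w * q) * b + (of_real s)\<^sup>2 * (w * cnj w) * b"
      using u v uv by (simp add: sesq_simps power2_eq_square algebra_simps)
    also have "\<dots> = of_real (c * s\<^sup>2 + m * s + - r) * b"
      unfolding m c(2) ab by (simp add: algebra_simps)
    also have "\<dots> = 0" unfolding that by simp
    finally show ?thesis using u v by (simp add: mem_isotropic_vectors)
  qed
  \<comment> \<open>The difference of the two isotropic vectors is a nonzero multiple of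
    \<open>v\<close>, so closure under addition would make \<open>v\<close> isotropic, against
    \<open>b \<noteq> 0\<close>.\<close>
  let ?d = "(of_real s1 - of_real s2) * w"
  have "(u + (of_real s1 * w) \<cdot>\<^sub>v v) + (-1) \<cdot>\<^sub>v (u + (of_real s2 * w) \<cdot>\<^sub>v v) = ?d \<cdot>\<^sub>v v"
    using u v by (intro eq_vecI) (auto simp: algebra_simps)
  then have "?d \<cdot>\<^sub>v v \<in> isotropic_vectors A"
    using add[OF mem[OF s(2)] isotropic_vectors_smult[OF mem[OF s(3)], of "-1"]] by simp
  then have "?d * cnj ?d * b = 0"
    using v by (auto simp add: mem_isotropic_vectors sesq_simps)
  then show False using b0 w0 s(1) by simp
qed

text \<open>The range is a continuous image of a compact set. Since \<open>n\<close> is a value and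
  not a type, vectors are encoded as functions on \<open>nat\<close> with the product
  topology.\<close>

lemma closed_numerical_range: "closed (numerical_range A)"
proof -
  \<comment> \<open>The box is compact by Tychonoff and the sum condition cuts out a closed subset;
    coordinates from \<open>n\<close> on range freely over the unit disc.\<close>
  define S :: "(nat \<Rightarrow> complex) set" where
    "S = (Pi\<^sub>E UNIV (\<lambda>_. cball 0 1)) \<inter> {f. (\<Sum>i<n. (cmod (f i))\<^sup>2) = 1}"
  define F where "F f = (\<Sum>i<n. (\<Sum>j<n. A $$ (i, j) * f j) * cnj (f i))" for f :: "nat \<Rightarrow> complex"
  have F: "F f = sesq A (Matrix.vec n f) (Matrix.vec n f)" for f
    using A by (simp add: F_def scalar_prod_def lessThan_atLeast0)
  have nrm: "euclidean_norm (Matrix.vec n f) = sqrt (\<Sum>i<n. (cmod (f i))\<^sup>2)" for f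
    by (simp add: euclidean_norm_def)
  have "compact (Pi\<^sub>E (UNIV :: nat set) (\<lambda>_. cball (0 :: complex) 1))"
    using compactin_PiE[of "\<lambda>_. euclidean" "UNIV :: nat set" "\<lambda>_. cball (0 :: complex) 1"]
    by (simp add: euclidean_product_topology)
  moreover have "closed {f :: nat \<Rightarrow> complex. (\<Sum>i<n. (cmod (f i))\<^sup>2) = 1}"
    by (intro closed_Collect_eq continuous_intros continuous_on_product_coordinates)
  ultimately have "compact S" unfolding S_def by (rule compact_Int_closed)
  moreover have "continuous_on S F"
    unfolding F_def
    by (intro continuous_intros continuous_on_subset[OF continuous_on_product_coordinates]) auto
  ultimately have "compact (F ` S)" by (rule compact_continuous_image[rotated])
  moreover have "F ` S = numerical_range A"
  proof (intro equalityI subsetI)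
    fix z assume "z \<in> F ` S"
    then obtain f where "f \<in> S" "z = F f" by blast
    then show "z \<in> numerical_range A"
      unfolding numerical_range_def F using A nrm[of f] by (auto simp: S_def intro!: exI[of _ "Matrix.vec n f"])
  next
    fix z assume "z \<in> numerical_range A"
    then obtain x where x: "x \<in> carrier_vec n" "euclidean_norm x = 1" "z = sesq A x x"
      using A by (auto simp: numerical_range_def)
    define f where "f i = (if i < n then vec_index x i else 0)" for i
    have xf: "x = Matrix.vec n f" using x(1) by (intro eq_vecI) (auto simp: f_def)
    have sum: "(\<Sum>i<n. (cmod (f i))\<^sup>2) = 1" using x(2) nrm[of f] by (simp add: xf)
    \<comment> \<open>No coordinate of a unit vector exceeds 1 in modulus, so the box contains every
      unit vector.\<close>
    have "cmod (f i) \<le> 1" for i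
    proof (cases "i < n")
      case True
      then have "(cmod (f i))\<^sup>2 \<le> (\<Sum>i<n. (cmod (f i))\<^sup>2)" by (intro member_le_sum) auto
      then show ?thesis using sum by (simp add: abs_square_le_1)
    qed (simp add: f_def)
    then have "f \<in> S" using sum by (auto simp: S_def)
    moreover have "z = F f" using x(3) F[of f] xf by simp
    ultimately show "z \<in> F ` S" by blast
  qed
  ultimately show ?thesis by (simp add: compact_imp_closed)
qed

end

theorem proposition2p1:
  fixes A :: "complex mat" and n :: nat
  assumes "A \<in> carrier_mat n n"
    and "0 \<in> frontier (numerical_range A)"
  shows "zero_dilation_index A \<le> vec_space.dim_span n (isotropic_vectors A) \<and>
    (zero_dilation_index A = vec_space.dim_span n (isotropic_vectors A) \<longleftrightarrow>
      0 extreme_point_of (numerical_range A))"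
proof -
  note A = assms(1)
  \<comment> \<open>This is where the boundary hypothesis enters: a closed set contains its
    frontier, and extremality requires membership.\<close>
  have "0 \<in> numerical_range A"
    using frontier_subset_closed[OF closed_numerical_range[OF A]] assms(2) by blast
  then have "0 extreme_point_of numerical_range A \<longleftrightarrow>
      (\<forall>x\<in>isotropic_vectors A. \<forall>y\<in>isotropic_vectors A. x + y \<in> isotropic_vectors A)"
    using isotropic_add_if_extreme[OF A] extreme_if_isotropic_add[OF A] by blast
  then show ?thesis
    using has_zero_compression_le_dim_span[OF A has_zero_compression_zero_dilation_index[OF A]]
      zero_dilation_index_eq_iff_isotropic_add[OF A] by simp
qed

end
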